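(* For every positive integer $n$, the perfect edge-magic deficiency of the star $K_{1,n}$ is finite: $\mu_p(K_{1,n})<+\infty$.
   Context: Graphs are finite and simple. The notation $[a,b]$ denotes the set of integers $x$ with $a\le x\le b$, and $G\cup mK_1$ is the disjoint union of $G$ with $m$ isolated vertices. An edge-magic labeling of a graph $G$ is a bijection $f:V(G)\cup E(G)\to[1,|V(G)|+|E(G)|]$ such that $f(u)+f(v)+f(uv)$ equals a constant (the valence of $f$) for every $uv\in E(G)$. For a graph $G$ with at least one edge, let $$T_G=\left\{\frac{\sum_{u\in V(G)}\deg(u)g(u)+\sum_{e\in E(G)}g(e)}{|E(G)|} : g:V(G)\cup E(G)\to[1,|V(G)|+|E(G)|]\text{ bijective}\right\}.$$ If $\lceil\min T_G\rceil\le\lfloor\max T_G\rfloor$, the edge-magic interval of $G$ is $\lambda_G=[\lceil\min T_G\rceil,\lfloor\max T_G\rfloor]$. The edge-magic set of $G$ is $$\tau_G=\{k\in\lambda_G : \text{there exists an edge-magic labeling of }G\text{ with valence }k\}.$$ $G$ is perfect edge-magic if $\lambda_G=\tau_G$. The perfect edge-magic deficiency $\mu_p(G)$ of a graph $G$ is the smallest nonnegative integer $m$ such that $G\cup mK_1$ is perfect edge-magic, or $+\infty$ if no such $m$ exists. *)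

theory Defs
  imports Complex_Main "HOL-Library.Extended_Nat"
begin

record 'a graph =
  verts :: "'a set"
  edges :: "'a set set"

definition simple_graph :: "'a graph \<Rightarrow> bool" where
  "simple_graph G \<longleftrightarrow>
     finite (verts G) \<and> (\<forall>e \<in> edges G. e \<subseteq> verts G \<and> card e = 2)"

definition deg :: "'a graph \<Rightarrow> 'a \<Rightarrow> nat" where
  "deg G v = card {e \<in> edges G. v \<in> e}"

definition star :: "nat \<Rightarrow> nat graph" where
  "star n = \<lparr>verts = {0..n}, edges = {{0, i} | i. i \<in> {1..n}}\<rparr>"

text \<open>The disjoint union of \<open>G\<close> with \<open>m\<close> isolated vertices; the latter are tagged by \<open>Inr\<close>.\<close>

definition add_isolated :: "'a graph \<Rightarrow> nat \<Rightarrow> ('a + nat) graph" where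
  "add_isolated G m = \<lparr>verts = verts G <+> {..<m}, edges = (\<lambda>e. Inl ` e) ` edges G\<rparr>"

lemma simple_graph_star: "simple_graph (star n)"
  by (auto simp: simple_graph_def star_def)

lemma simple_graph_add_isolated:
  assumes "simple_graph G"
  shows "simple_graph (add_isolated G m)"
  using assms by (auto simp: simple_graph_def add_isolated_def card_image)

text \<open>
  A labeling is a function on the disjoint union of the vertex set (tag \<open>Inl\<close>) and the edge
  set (tag \<open>Inr\<close>); its values outside that domain are irrelevant.
\<close>

definition total_labeling :: "'a graph \<Rightarrow> ('a + 'a set \<Rightarrow> int) \<Rightarrow> bool" where
  "total_labeling G g \<longleftrightarrow>
     bij_betw g (verts G <+> edges G) {1..int (card (verts G) + card (edges G))}"

definition edge_magic_labeling :: "'a graph \<Rightarrow> ('a + 'a set \<Rightarrow> int) \<Rightarrow> int \<Rightarrow> bool" where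
  "edge_magic_labeling G f k \<longleftrightarrow>
     total_labeling G f \<and>
     (\<forall>u v. {u, v} \<in> edges G \<longrightarrow> f (Inl u) + f (Inl v) + f (Inr {u, v}) = k)"

definition T_set :: "'a graph \<Rightarrow> real set" where
  "T_set G =
     {of_int ((\<Sum>u\<in>verts G. int (deg G u) * g (Inl u)) + (\<Sum>e\<in>edges G. g (Inr e)))
        / real (card (edges G)) | g. total_labeling G g}"

definition edge_magic_interval :: "'a graph \<Rightarrow> int set" where
  "edge_magic_interval G = {\<lceil>Min (T_set G)\<rceil>..\<lfloor>Max (T_set G)\<rfloor>}"

definition edge_magic_set :: "'a graph \<Rightarrow> int set" where
  "edge_magic_set G = {k \<in> edge_magic_interval G. \<exists>f. edge_magic_labeling G f k}"

text \<open>
  The edge-magic interval is only defined for graphs with an edge for which the lower bound does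
  not exceed the upper bound. The first two conjuncts express that it is defined.
\<close>

definition perfect_edge_magic :: "'a graph \<Rightarrow> bool" where
  "perfect_edge_magic G \<longleftrightarrow>
     edges G \<noteq> {} \<and> \<lceil>Min (T_set G)\<rceil> \<le> \<lfloor>Max (T_set G)\<rfloor> \<and>
     edge_magic_interval G = edge_magic_set G"

definition perfect_edge_magic_deficiency :: "'a graph \<Rightarrow> enat" where
  "perfect_edge_magic_deficiency G =
     (if \<exists>m. perfect_edge_magic (add_isolated G m)
      then enat (LEAST m. perfect_edge_magic (add_isolated G m))
      else \<infinity>)"

end

theory Submission
  imports Defs
begin

text \<open>
  A single isolated vertex suffices. The labels \<open>1, \<dots>, 2n + 2\<close> split into \<open>n + 1\<close> pairs
  with sum \<open>2n + 3\<close>. For any \<open>c\<close>, label the centre by \<open>c\<close>, the isolated vertex by the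
  partner of \<open>c\<close>, and each leaf together with its edge by one of the other \<open>n\<close> pairs: the valence
  is \<open>c + 2n + 3\<close>. Conversely, as the label sum is \<open>(n + 1)(2n + 3)\<close>, the elements of \<open>T_set\<close>
  are \<open>((n + 1)(2n + 3) + (n - 1) a - b) / n\<close> with \<open>a, b\<close> the labels of the centre and
  of the isolated vertex, so they lie between \<open>2n + 4\<close> and \<open>4n + 5\<close>,
  which are the valences obtained for \<open>c = 1\<close> and \<open>c = 2n + 2\<close>.
\<close>

section \<open>Edges, sizes and degrees of the star with one isolated vertex\<close>

definition spoke :: "nat \<Rightarrow> (nat + nat) set" where
  "spoke i = {Inl 0, Inl i}"

lemma spoke_eq_iff [simp]: "spoke i = spoke j \<longleftrightarrow> i = j"
  by (auto simp: spoke_def doubleton_eq_iff)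

lemma inj_on_spoke: "inj_on spoke A"
  by (simp add: inj_on_def)

lemma verts_star_isolated: "verts (add_isolated (star n) 1) = {0..n} <+> {0}"
  by (simp add: add_isolated_def star_def lessThan_Suc)

lemma edges_star_isolated: "edges (add_isolated (star n) m) = spoke ` {1..n}"
proof -
  have "edges (star n) = (\<lambda>i. {0, i}) ` {1..n}"
    by (auto simp: star_def)
  then show ?thesis
    by (simp add: add_isolated_def spoke_def image_image)
qed

lemma card_edges_star_isolated: "card (edges (add_isolated (star n) m)) = n"
  by (simp add: edges_star_isolated card_image inj_on_spoke)

lemma card_verts_star_isolated: "card (verts (add_isolated (star n) 1)) = n + 2"
  unfolding verts_star_isolated by (simp add: card_Plus)

lemma deg_centre: "deg (add_isolated (star n) m) (Inl 0) = n"
proof -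
  have "{e \<in> spoke ` {1..n}. Inl 0 \<in> e} = spoke ` {1..n}"
    by (auto simp: spoke_def)
  then show ?thesis
    by (simp add: deg_def edges_star_isolated card_image inj_on_spoke)
qed

lemma deg_leaf:
  assumes "i \<in> {1..n}"
  shows "deg (add_isolated (star n) m) (Inl i) = 1"
proof -
  have "{e \<in> spoke ` {1..n}. Inl i \<in> e} = {spoke i}"
    using assms by (auto simp: spoke_def)
  then show ?thesis
    by (simp add: deg_def edges_star_isolated)
qed

lemma deg_isolated: "deg (add_isolated (star n) m) (Inr j) = 0"
proof -
  have "{e \<in> spoke ` {1..n}. Inr j \<in> e} = {}"
    by (auto simp: spoke_def)
  then show ?thesis
    by (simp add: deg_def edges_star_isolated)
qed

lemma total_labeling_star_isolated:
  "total_labeling (add_isolated (star n) 1) g \<longleftrightarrow>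
     bij_betw g (({0..n} <+> {0}) <+> spoke ` {1..n}) {1..2 * int n + 2}"
proof -
  let ?G = "add_isolated (star n) 1"
  have "int (card (verts ?G) + card (edges ?G)) = 2 * int n + 2"
    unfolding card_verts_star_isolated card_edges_star_isolated by simp
  then show ?thesis
    unfolding total_labeling_def verts_star_isolated edges_star_isolated by (simp only:)
qed

section \<open>Weighted label sums\<close>

lemma gauss_sum_int: "\<Sum>{1..2 * int n + 2} = (int n + 1) * (2 * int n + 3)"
proof (induction n)
  case 0
  have "{1..2::int} = {1, 2}" by auto
  then show ?case by simp
next
  case (Suc n)
  have "{1..2 * int (Suc n) + 2} = insert (2 * int n + 4) (insert (2 * int n + 3) {1..2 * int n + 2})"
    by auto
  with Suc show ?case by (simp add: algebra_simps)
qed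

text \<open>Weighting by degree counts the centre \<open>n\<close> times, each leaf once and the
  isolated vertex not at all. Compared with the sum of all labels, this gains \<open>n - 1\<close>
  copies of the centre label and loses the label of the isolated vertex.\<close>

lemma weight_star_isolated:
  fixes n :: nat
  defines "G \<equiv> add_isolated (star n) 1"
  assumes "total_labeling G g"
  shows "(\<Sum>u\<in>verts G. int (deg G u) * g (Inl u)) + (\<Sum>e\<in>edges G. g (Inr e)) =
    (int n + 1) * (2 * int n + 3) + (int n - 1) * g (Inl (Inl 0)) - g (Inl (Inr 0))"
proof -
  have atLeast0: "{0..n} = insert 0 {1..n}" by auto
  have "bij_betw g (({0..n} <+> {0}) <+> spoke ` {1..n}) {1..2 * int n + 2}"
    using assms total_labeling_star_isolated by blast
  then have "sum g (({0..n} <+> {0}) <+> spoke ` {1..n}) = (int n + 1) * (2 * int n + 3)"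
    using sum.reindex_bij_betw[of g _ _ "\<lambda>x. x"] gauss_sum_int by metis
  then have "g (Inl (Inl 0)) + (\<Sum>i\<in>{1..n}. g (Inl (Inl i))) + g (Inl (Inr 0))
      + (\<Sum>e\<in>spoke ` {1..n}. g (Inr e)) = (int n + 1) * (2 * int n + 3)"
    by (simp add: sum.Plus atLeast0)
  moreover have "(\<Sum>u\<in>verts G. int (deg G u) * g (Inl u)) =
      int n * g (Inl (Inl 0)) + (\<Sum>i\<in>{1..n}. g (Inl (Inl i)))"
    unfolding G_def verts_star_isolated
    by (simp add: sum.Plus atLeast0 deg_centre deg_isolated deg_leaf del: One_nat_def)
  ultimately show ?thesis
    by (simp add: G_def edges_star_isolated algebra_simps)
qed

section \<open>Edge-magic labelings with a prescribed centre label\<close>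

text \<open>For \<open>p \<ge> 1\<close>, on positive indices this is the increasing enumeration of
  the positive integers other than \<open>p\<close>.\<close>

definition skip :: "int \<Rightarrow> nat \<Rightarrow> int" where
  "skip p i = (if int i < p then int i else int i + 1)"

lemma skip_image:
  assumes "p \<in> {1..int n + 1}"
  shows "skip p ` {1..n} = {1..int n + 1} - {p}"
proof
  show "skip p ` {1..n} \<subseteq> {1..int n + 1} - {p}"
    using assms by (auto simp: skip_def)
  show "{1..int n + 1} - {p} \<subseteq> skip p ` {1..n}"
  proof
    fix x assume "x \<in> {1..int n + 1} - {p}"
    \<comment> \<open>Labels below \<open>p\<close> are their own index; labels above
      \<open>p\<close> are shifted back by one.\<close>
    then have "x = skip p (if x < p then nat x else nat (x - 1))"
      and "(if x < p then nat x else nat (x - 1)) \<in> {1..n}"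
      using assms by (auto simp: skip_def)
    then show "x \<in> skip p ` {1..n}" by blast
  qed
qed

text \<open>Each pair with sum \<open>s\<close> is represented by its smaller member, and
  \<open>min c (s - c)\<close> represents the pair of \<open>c\<close>. Thus \<open>h\<close> runs
  through the representatives of the remaining pairs: a leaf gets the smaller member, its edge the
  larger one.\<close>

definition magic :: "nat \<Rightarrow> int \<Rightarrow> (nat + nat) + (nat + nat) set \<Rightarrow> int" where
  "magic n c x =
    (let s = 2 * int n + 3; h = skip (min c (s - c)) in
      case x of
        Inl (Inl i) \<Rightarrow> if i = 0 then c else h i
      | Inl (Inr j) \<Rightarrow> s - c
      | Inr e \<Rightarrow> s - h (the_inv spoke e))"

lemma magic_spoke: "magic n c (Inr (spoke i)) = 2 * int n + 3 - skip (min c (2 * int n + 3 - c)) i"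
  by (simp add: magic_def Let_def the_inv_f_f inj_on_spoke)

lemma edge_magic_labeling_magic:
  assumes "c \<in> {1..2 * int n + 2}"
  shows "edge_magic_labeling (add_isolated (star n) 1) (magic n c) (c + 2 * int n + 3)"
proof -
  define s where "s = 2 * int n + 3"
  define p where "p = min c (s - c)"
  let ?D = "({0..n} <+> {0}) <+> spoke ` {1..n}"
  have p: "p \<in> {1..int n + 1}"
    using assms by (auto simp: p_def s_def)
  have atLeast0: "{0..n} = insert 0 {1..n}" by auto
  have leaves: "(\<lambda>i. magic n c (Inl (Inl i))) ` {1..n} = {1..int n + 1} - {p}"
    unfolding skip_image[OF p, symmetric]
    by (auto intro!: image_cong simp: magic_def Let_def p_def s_def)
  have "(\<lambda>i. magic n c (Inr (spoke i))) ` {1..n} = (-) s ` skip p ` {1..n}"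
    by (simp add: magic_spoke image_image p_def s_def)
  \<comment> \<open>The reflection \<open>x \<mapsto> s - x\<close> carries the lower half of the
    labels, without \<open>p\<close>, to the upper half without \<open>s - p\<close>.\<close>
  also have "\<dots> = (-) s ` {1..int n + 1} - {s - p}"
    unfolding skip_image[OF p] by (simp add: image_set_diff inj_on_def)
  also have "(-) s ` {1..int n + 1} = {int n + 2..s - 1}"
    by (simp add: s_def)
  finally have spokes: "(\<lambda>i. magic n c (Inr (spoke i))) ` {1..n} = {int n + 2..s - 1} - {s - p}" .
  have rest: "magic n c (Inl (Inl 0)) = c" "magic n c (Inl (Inr 0)) = s - c"
    by (simp_all add: magic_def Let_def s_def)
  have "magic n c ` ?D = {c, s - c} \<union> ({1..int n + 1} - {p}) \<union> ({int n + 2..s - 1} - {s - p})"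
    unfolding Plus_def image_Un image_image atLeast0 image_insert leaves spokes rest by auto
  \<comment> \<open>Whether \<open>c\<close> is the smaller or the larger member of its pair, the
    pair is the same.\<close>
  also have "\<dots> = {p, s - p} \<union> ({1..int n + 1} - {p}) \<union> ({int n + 2..s - 1} - {s - p})"
    by (auto simp: p_def min_def)
  also have "\<dots> = {1..2 * int n + 2}"
    using p by (auto simp: s_def)
  finally have image: "magic n c ` ?D = {1..2 * int n + 2}" .
  \<comment> \<open>Injectivity follows by counting: the image has as many elements as the
    domain.\<close>
  have "card (magic n c ` ?D) = 2 * n + 2"
    unfolding image by (simp add: nat_eq_iff)
  also have "\<dots> = card ?D"
    by (simp add: card_Plus card_image inj_on_spoke)
  finally have "inj_on (magic n c) ?D"
    by (intro eq_card_imp_inj_on) auto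
  then have "total_labeling (add_isolated (star n) 1) (magic n c)"
    using image total_labeling_star_isolated bij_betw_def by blast
  moreover have "magic n c (Inl u) + magic n c (Inl v) + magic n c (Inr {u, v}) = c + 2 * int n + 3"
    if uv: "{u, v} \<in> spoke ` {1..n}" for u v
  proof -
    obtain i where i: "i \<in> {1..n}" "{u, v} = spoke i"
      using uv by blast
    then have "u = Inl 0 \<and> v = Inl i \<or> u = Inl i \<and> v = Inl 0"
      by (auto simp: spoke_def doubleton_eq_iff)
    \<comment> \<open>The leaf and its edge contribute \<open>h i + (s - h i) = s\<close>, whatever
      the pair.\<close>
    moreover have "magic n c (Inl (Inl 0)) + magic n c (Inl (Inl i)) + magic n c (Inr (spoke i)) =
        c + 2 * int n + 3"
      using i(1) by (simp add: magic_spoke) (simp add: magic_def Let_def)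
    ultimately show ?thesis
      unfolding i(2) by (elim disjE conjE) (simp_all only: add.commute)
  qed
  ultimately show ?thesis
    unfolding edge_magic_labeling_def edges_star_isolated by (intro conjI allI impI)
qed

section \<open>The edge-magic interval and perfection\<close>

text \<open>Bounding the integer numerators yields the finiteness of \<open>T_set G\<close> along
  with the bounds, as \<open>Min\<close> and \<open>Max\<close> require.\<close>

lemma T_set_star_isolated_bounds:
  fixes n :: nat
  assumes "n \<ge> 1"
  defines "G \<equiv> add_isolated (star n) 1"
  shows "T_set G \<subseteq> (\<lambda>w. of_int w / real n) ` {int n * (2 * int n + 4)..int n * (4 * int n + 5)}"
proof
  fix x assume "x \<in> T_set G"
  then obtain g where g: "total_labeling G g"
    and x: "x = of_int ((\<Sum>u\<in>verts G. int (deg G u) * g (Inl u)) + (\<Sum>e\<in>edges G. g (Inr e)))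
      / real n"
    unfolding T_set_def G_def card_edges_star_isolated by blast
  let ?a = "g (Inl (Inl 0))" and ?b = "g (Inl (Inr 0))"
  let ?w = "(int n + 1) * (2 * int n + 3) + (int n - 1) * ?a - ?b"
  have bij: "bij_betw g (({0..n} <+> {0}) <+> spoke ` {1..n}) {1..2 * int n + 2}"
    using g unfolding G_def total_labeling_star_isolated .
  have "?a \<in> {1..2 * int n + 2}" "?b \<in> {1..2 * int n + 2}"
    by (rule bij_betw_apply[OF bij], simp only: InlI atLeastAtMost_iff le0 InrI insertI1)+
  \<comment> \<open>Since \<open>n - 1 \<ge> 0\<close>, the extremes of \<open>?w\<close> are
    bounded by taking \<open>?a = 1\<close>, \<open>?b = 2n + 2\<close> and
    \<open>?a = 2n + 2\<close>, \<open>?b = 1\<close>.\<close>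
  moreover from this have "(int n - 1) * 1 \<le> (int n - 1) * ?a"
    "(int n - 1) * ?a \<le> (int n - 1) * (2 * int n + 2)"
    using \<open>n \<ge> 1\<close> by (intro mult_left_mono; simp)+
  ultimately have "?w \<in> {int n * (2 * int n + 4)..int n * (4 * int n + 5)}"
    by (auto simp: algebra_simps)
  moreover have "x = of_int ?w / real n"
    unfolding x G_def weight_star_isolated[OF g[unfolded G_def]] ..
  ultimately show "x \<in> (\<lambda>w. of_int w / real n) ` {int n * (2 * int n + 4)..int n * (4 * int n + 5)}"
    by blast
qed

text \<open>The weight formula with centre label \<open>c\<close> and isolated label
  \<open>2n + 3 - c\<close> gives exactly \<open>n\<close> times the valence.\<close>

lemma valence_in_T_set:
  assumes "n \<ge> 1" "c \<in> {1..2 * int n + 2}"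
  shows "of_int (c + 2 * int n + 3) \<in> T_set (add_isolated (star n) 1)"
proof -
  let ?G = "add_isolated (star n) 1" and ?g = "magic n c"
  have g: "total_labeling ?G ?g"
    using edge_magic_labeling_magic[OF assms(2)] by (simp add: edge_magic_labeling_def)
  have "(\<Sum>u\<in>verts ?G. int (deg ?G u) * ?g (Inl u)) + (\<Sum>e\<in>edges ?G. ?g (Inr e)) =
      int n * (c + 2 * int n + 3)"
    unfolding weight_star_isolated[OF g] by (simp add: magic_def Let_def algebra_simps)
  moreover have "of_int (c + 2 * int n + 3) = of_int (int n * (c + 2 * int n + 3)) / real n"
    using assms(1) by simp
  ultimately have "of_int (c + 2 * int n + 3) =
      of_int ((\<Sum>u\<in>verts ?G. int (deg ?G u) * ?g (Inl u)) + (\<Sum>e\<in>edges ?G. ?g (Inr e))) / real n"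
    by (simp only:)
  with g show ?thesis
    unfolding T_set_def card_edges_star_isolated by blast
qed

lemma edge_magic_interval_star_isolated:
  assumes "n \<ge> 1"
  shows "edge_magic_interval (add_isolated (star n) 1) = {2 * int n + 4..4 * int n + 5}"
proof -
  let ?T = "T_set (add_isolated (star n) 1)"
  note sub = T_set_star_isolated_bounds[OF assms]
  have fin: "finite ?T"
    using finite_subset[OF sub] by simp
  have bounds: "of_int (2 * int n + 4) \<le> x \<and> x \<le> of_int (4 * int n + 5)" if "x \<in> ?T" for x
  proof -
    obtain w where w: "x = of_int w / real n"
      "int n * (2 * int n + 4) \<le> w" "w \<le> int n * (4 * int n + 5)"
      using subsetD[OF sub \<open>x \<in> ?T\<close>] by (blast dest: atLeastAtMost_iff[THEN iffD1])
    have "real_of_int (int n * (2 * int n + 4)) \<le> of_int w"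
      "of_int w \<le> real_of_int (int n * (4 * int n + 5))"
      using w(2,3) of_int_le_iff by blast+
    then show ?thesis
      using assms by (simp add: w(1) field_simps)
  qed
  \<comment> \<open>The extreme centre labels attain both bounds, so the minimum and maximum are
    integers and rounding changes nothing.\<close>
  have "of_int (2 * int n + 4) \<in> ?T" "of_int (4 * int n + 5) \<in> ?T"
    using valence_in_T_set[OF assms, of 1] valence_in_T_set[OF assms, of "2 * int n + 2"]
    by (simp_all add: algebra_simps)
  then have "Min ?T = of_int (2 * int n + 4)" "Max ?T = of_int (4 * int n + 5)"
    using fin bounds by (auto intro!: Min_eqI Max_eqI)
  then show ?thesis
    unfolding edge_magic_interval_def by (simp only: ceiling_of_int floor_of_int)
qed

lemma perfect_edge_magic_star_isolated:
  assumes "n \<ge> 1"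
  shows "perfect_edge_magic (add_isolated (star n) 1)"
proof -
  let ?G = "add_isolated (star n) 1"
  have "\<exists>f. edge_magic_labeling ?G f k" if "k \<in> edge_magic_interval ?G" for k
  proof -
    \<comment> \<open>Solving \<open>k = c + 2n + 3\<close> for the centre label: as
      \<open>k\<close> runs through the interval, \<open>c\<close> runs through all labels.\<close>
    have "k - 2 * int n - 3 \<in> {1..2 * int n + 2}"
      using that unfolding edge_magic_interval_star_isolated[OF assms] by simp
    from edge_magic_labeling_magic[OF this] show ?thesis by auto
  qed
  then have "edge_magic_interval ?G = edge_magic_set ?G"
    by (auto simp: edge_magic_set_def)
  moreover have "\<lceil>Min (T_set ?G)\<rceil> \<le> \<lfloor>Max (T_set ?G)\<rfloor>"
    using edge_magic_interval_star_isolated[OF assms] unfolding edge_magic_interval_def by auto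
  moreover have "edges ?G \<noteq> {}"
    using assms by (simp add: edges_star_isolated)
  ultimately show ?thesis
    by (simp add: perfect_edge_magic_def)
qed

theorem theorem3p4:
  fixes n :: nat
  assumes "n \<ge> 1"
  shows "perfect_edge_magic_deficiency (star n) < \<infinity>"
  using perfect_edge_magic_star_isolated[OF assms]
  by (auto simp: perfect_edge_magic_deficiency_def)

end
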